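(* Let $p,q\ge1$, $\nu>0$, and let $\mathbf{Y}\sim SUT_{p,q}(\boldsymbol{\mu},\boldsymbol{\Sigma},\boldsymbol{\Lambda},\boldsymbol{\tau},\nu,\boldsymbol{\Psi})$. Let $\mathbf{a},\mathbf{b}$ be $p$-dimensional truncation limits (entries possibly infinite) and $\mathbf{k}=(k_1,\dots,k_p)^\top\in\mathbb{N}^p$. Then $$\mathbb{E}[\mathbf{Y}^{\mathbf{k}}\mid\mathbf{a}\le\mathbf{Y}\le\mathbf{b}]=\mathbb{E}[\mathbf{X}^{\boldsymbol{\kappa}}\mid\boldsymbol{\alpha}\le\mathbf{X}\le\boldsymbol{\beta}],$$ where $\mathbf{X}\sim t_{q+p}(\boldsymbol{\xi},\boldsymbol{\Omega},\nu)$ with $$\boldsymbol{\xi}=\begin{pmatrix}\boldsymbol{\tau}\\ \boldsymbol{\mu}\end{pmatrix},\qquad \boldsymbol{\Omega}=\begin{pmatrix}\boldsymbol{\Psi}+\boldsymbol{\Lambda}^\top\boldsymbol{\Lambda}&\boldsymbol{\Omega}_{12}\\ \boldsymbol{\Omega}_{21}&\boldsymbol{\Sigma}\end{pmatrix},\qquad \boldsymbol{\Omega}_{21}=\boldsymbol{\Sigma}^{1/2}\boldsymbol{\Lambda}=\boldsymbol{\Omega}_{12}^\top,$$ and $\boldsymbol{\kappa}=(\mathbf{0}_q^\top,\mathbf{k}^\top)^\top$, $\boldsymbol{\alpha}=(\mathbf{0}_q^\top,\mathbf{a}^\top)^\top$, $\boldsymbol{\beta}=(\boldsymbol{\infty}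_q^\top,\mathbf{b}^\top)^\top$.
   Context: Parameters: $\boldsymbol{\mu}\in\mathbb{R}^p$; $\boldsymbol{\Sigma}\in\mathbb{R}^{p\times p}$ positive definite with symmetric square root $\boldsymbol{\Sigma}^{1/2}$; $\boldsymbol{\Lambda}\in\mathbb{R}^{p\times q}$; $\boldsymbol{\tau}\in\mathbb{R}^q$; $\boldsymbol{\Psi}\in\mathbb{R}^{q\times q}$ a positive-definite correlation matrix; $\nu>0$. $t_r(\boldsymbol{\xi},\boldsymbol{\Omega},\nu)$ is the $r$-variate Student-$t$ distribution with location $\boldsymbol{\xi}$, scale matrix $\boldsymbol{\Omega}$ and $\nu$ degrees of freedom; $t_p(\cdot;\boldsymbol{\mu},\boldsymbol{\Sigma},\nu)$ is its density for $r=p$, and $T_q(\cdot;\boldsymbol{\Psi},\nu)$ is the cdf of $t_q(\mathbf{0},\boldsymbol{\Psi},\nu)$. Unified skew-$t$ distribution: $\mathbf{Y}\sim SUT_{p,q}(\boldsymbol{\mu},\boldsymbol{\Sigma},\boldsymbol{\Lambda},\boldsymbol{\tau},\nu,\boldsymbol{\Psi})$ means that $\mathbf{Y}$ has density $$t_p(\mathbf{y};\boldsymbol{\mu},\boldsymbol{\Sigma},\nu)\,\frac{T_q\big((\boldsymbol{\tau}+\boldsymbol{\Lambda}^\top\boldsymbol{\Sigma}^{-1/2}(\mathbf{y}-\boldsymbol{\mu}))\,\nu(\mathbf{y});\boldsymbol{\Psi},\nu+p\big)}{T_q(\boldsymbol{\tau};\boldsymbol{\Psi}+\boldsymbol{\Lambda}^\top\boldsymbol{\Lambda},\nu)},\qquad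 \nu(\mathbf{y})^2=\frac{\nu+p}{\nu+(\mathbf{y}-\boldsymbol{\mu})^\top\boldsymbol{\Sigma}^{-1}(\mathbf{y}-\boldsymbol{\mu})};$$ equivalently, with $\mathbf{X}=(\mathbf{X}_1^\top,\mathbf{X}_2^\top)^\top\sim t_{q+p}(\boldsymbol{\xi},\boldsymbol{\Omega},\nu)$ ($\mathbf{X}_1\in\mathbb{R}^q$, $\mathbf{X}_2\in\mathbb{R}^p$) and $\boldsymbol\xi,\boldsymbol\Omega$ as in the claim, $\mathbf{Y}\overset{d}{=}(\mathbf{X}_2\mid\mathbf{X}_1>\mathbf{0})$. $\mathbf{y}^{\mathbf{k}}$ inside an expectation denotes $y_1^{k_1}\cdots y_p^{k_p}$ (similarly $\mathbf{x}^{\boldsymbol\kappa}$); $\mathbb{N}$ includes $0$; vector inequalities are componentwise. Conditioning events are assumed to have positive probability, and the identity concerns moments that exist. *)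

theory Defs
  imports "HOL-Probability.Probability"
begin

definition pos_def_mat :: "real ^ 'n ^ 'n \<Rightarrow> bool" where
  "pos_def_mat A \<longleftrightarrow> transpose A = A \<and> (\<forall>x. x \<noteq> 0 \<longrightarrow> 0 < x \<bullet> (A *v x))"

definition correlation_mat :: "real ^ 'n ^ 'n \<Rightarrow> bool" where
  "correlation_mat A \<longleftrightarrow> pos_def_mat A \<and> (\<forall>i. A $ i $ i = 1)"

(* R is a symmetric square root of A; it need not be the positive definite one. *)
definition symmetric_sqrt_mat :: "real ^ 'n ^ 'n \<Rightarrow> real ^ 'n ^ 'n \<Rightarrow> bool" where
  "symmetric_sqrt_mat A R \<longleftrightarrow> transpose R = R \<and> R ** R = A"

definition join_vec :: "'a ^ 'm \<Rightarrow> 'a ^ 'n \<Rightarrow> 'a ^ ('m + 'n)" where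
  "join_vec u v = (\<chi> i. case i of Inl j \<Rightarrow> u $ j | Inr j \<Rightarrow> v $ j)"

definition block_mat ::
  "'a ^ 'm ^ 'm \<Rightarrow> 'a ^ 'n ^ 'm \<Rightarrow> 'a ^ 'm ^ 'n \<Rightarrow> 'a ^ 'n ^ 'n \<Rightarrow> 'a ^ ('m + 'n) ^ ('m + 'n)" where
  "block_mat A B C D =
    (\<chi> i. case i of Inl j \<Rightarrow> join_vec (A $ j) (B $ j) | Inr j \<Rightarrow> join_vec (C $ j) (D $ j))"

definition mahalanobis2 :: "real ^ 'n \<Rightarrow> real ^ 'n ^ 'n \<Rightarrow> real ^ 'n \<Rightarrow> real" where
  "mahalanobis2 \<xi> \<Omega> x = (x - \<xi>) \<bullet> (matrix_inv \<Omega> *v (x - \<xi>))"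

definition t_density :: "real ^ 'n \<Rightarrow> real ^ 'n ^ 'n \<Rightarrow> real \<Rightarrow> real ^ 'n \<Rightarrow> real" where
  "t_density \<xi> \<Omega> \<nu> x =
     Gamma ((\<nu> + real CARD('n)) / 2)
       / (Gamma (\<nu> / 2) * (\<nu> * pi) powr (real CARD('n) / 2) * sqrt (det \<Omega>))
     * (1 + mahalanobis2 \<xi> \<Omega> x / \<nu>) powr (- ((\<nu> + real CARD('n)) / 2))"

(* The order on vectors is componentwise, so this is the joint distribution function. *)
definition t_cdf :: "real ^ 'n ^ 'n \<Rightarrow> real \<Rightarrow> real ^ 'n \<Rightarrow> real" where
  "t_cdf \<Psi> \<nu> z = measure (density lborel (\<lambda>x. ennreal (t_density 0 \<Psi> \<nu> x))) {x. x \<le> z}"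

definition t_distributed ::
  "'a measure \<Rightarrow> ('a \<Rightarrow> real ^ 'n) \<Rightarrow> real ^ 'n \<Rightarrow> real ^ 'n ^ 'n \<Rightarrow> real \<Rightarrow> bool" where
  "t_distributed M X \<xi> \<Omega> \<nu> \<longleftrightarrow> distributed M lborel X (\<lambda>x. ennreal (t_density \<xi> \<Omega> \<nu> x))"

(* R is the square root of \<Sigma> entering through the skewing term. *)
definition sut_density ::
  "real ^ 'p \<Rightarrow> real ^ 'p ^ 'p \<Rightarrow> real ^ 'p ^ 'p \<Rightarrow> real ^ 'q ^ 'p \<Rightarrow> real ^ 'q \<Rightarrow> real
    \<Rightarrow> real ^ 'q ^ 'q \<Rightarrow> real ^ 'p \<Rightarrow> real" where
  "sut_density \<mu> \<Sigma> R \<Lambda> \<tau> \<nu> \<Psi> y =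
     t_density \<mu> \<Sigma> \<nu> y *
     t_cdf \<Psi> (\<nu> + real CARD('p))
       (sqrt ((\<nu> + real CARD('p)) / (\<nu> + mahalanobis2 \<mu> \<Sigma> y))
          *\<^sub>R (\<tau> + transpose \<Lambda> *v (matrix_inv R *v (y - \<mu>))))
     / t_cdf (\<Psi> + transpose \<Lambda> ** \<Lambda>) \<nu> \<tau>"

definition sut_distributed ::
  "'a measure \<Rightarrow> ('a \<Rightarrow> real ^ 'p) \<Rightarrow> real ^ 'p \<Rightarrow> real ^ 'p ^ 'p \<Rightarrow> real ^ 'p ^ 'p
    \<Rightarrow> real ^ 'q ^ 'p \<Rightarrow> real ^ 'q \<Rightarrow> real \<Rightarrow> real ^ 'q ^ 'q \<Rightarrow> bool" where
  "sut_distributed M Y \<mu> \<Sigma> R \<Lambda> \<tau> \<nu> \<Psi> \<longleftrightarrow>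
     distributed M lborel Y (\<lambda>y. ennreal (sut_density \<mu> \<Sigma> R \<Lambda> \<tau> \<nu> \<Psi> y))"

definition trunc_box :: "ereal ^ 'n \<Rightarrow> ereal ^ 'n \<Rightarrow> (real ^ 'n) set" where
  "trunc_box a b = {x. \<forall>i. a $ i \<le> ereal (x $ i) \<and> ereal (x $ i) \<le> b $ i}"

definition vec_power :: "real ^ 'n \<Rightarrow> nat ^ 'n \<Rightarrow> real" where
  "vec_power x k = (\<Prod>i\<in>UNIV. (x $ i) ^ (k $ i))"

definition trunc_event ::
  "'a measure \<Rightarrow> ('a \<Rightarrow> real ^ 'n) \<Rightarrow> ereal ^ 'n \<Rightarrow> ereal ^ 'n \<Rightarrow> 'a set" where
  "trunc_event M X a b = {\<omega> \<in> space M. X \<omega> \<in> trunc_box a b}"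

definition trunc_moment_exists ::
  "'a measure \<Rightarrow> ('a \<Rightarrow> real ^ 'n) \<Rightarrow> ereal ^ 'n \<Rightarrow> ereal ^ 'n \<Rightarrow> nat ^ 'n \<Rightarrow> bool" where
  "trunc_moment_exists M X a b k \<longleftrightarrow>
     integrable (uniform_measure M (trunc_event M X a b)) (\<lambda>\<omega>. vec_power (X \<omega>) k)"

(* uniform_measure M A is the law M conditioned on the event A, not a uniform distribution. *)
definition trunc_moment ::
  "'a measure \<Rightarrow> ('a \<Rightarrow> real ^ 'n) \<Rightarrow> ereal ^ 'n \<Rightarrow> ereal ^ 'n \<Rightarrow> nat ^ 'n \<Rightarrow> real" where
  "trunc_moment M X a b k =
     (LINT \<omega>|uniform_measure M (trunc_event M X a b). vec_power (X \<omega>) k)"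

end

(*
  The inverse of \<Omega> is known through its Schur complement, which is \<Psi>: the quadratic form of
  \<Omega>^-1 at (x, y) splits into that of \<Sigma>^-1 at y - \<mu> plus that of \<Psi>^-1 at x - m(y), where
  m(y) = \<tau> + \<Lambda>^T R^-1 (y - \<mu>). Hence the density of X at (x, y) is, up to a constant, the density
  t_p(y; \<mu>, \<Sigma>, \<nu>) times a t_q density with \<nu> + p degrees of freedom, located at m(y) and rescaled
  by \<nu>(y). Integrating x over the orthant x >= 0 turns the second factor into the distribution
  function in the numerator of the SUT density. So the law of X_2 on {X_1 >= 0} is proportional to
  the law of Y, and constants of proportionality disappear on conditioning.
*)
theory Submission
  imports Defs
begin

section \<open>Positive definite matrices\<close>

lemma inner_transpose_mult:
  fixes A :: "real ^ 'n ^ 'm"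
  shows "(transpose A *v x) \<bullet> y = x \<bullet> (A *v y)"
  by (simp add: dot_lmul_matrix)

lemma inner_symmetric_mult:
  fixes A :: "real ^ 'n ^ 'n"
  assumes "transpose A = A"
  shows "(A *v x) \<bullet> y = x \<bullet> (A *v y)"
  using inner_transpose_mult[of A x y] assms by simp

lemma matrix_inv_mult_vec:
  fixes A :: "real ^ 'n ^ 'n"
  assumes "invertible A"
  shows "A *v (matrix_inv A *v x) = x" "matrix_inv A *v (A *v x) = x"
proof -
  have "A ** matrix_inv A = mat 1 \<and> matrix_inv A ** A = mat 1"
    using assms unfolding invertible_def matrix_inv_def by (rule someI_ex)
  then show "A *v (matrix_inv A *v x) = x" "matrix_inv A *v (A *v x) = x"
    by (simp_all add: matrix_vector_mul_assoc)
qed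

lemma inner_matrix_inv_symmetric:
  fixes A :: "real ^ 'n ^ 'n"
  assumes "invertible A" "transpose A = A"
  shows "(matrix_inv A *v x) \<bullet> y = x \<bullet> (matrix_inv A *v y)"
  using inner_symmetric_mult[OF assms(2), of "matrix_inv A *v x" "matrix_inv A *v y"]
  by (simp add: matrix_inv_mult_vec[OF assms(1)])

text \<open>A kernel vector x would satisfy x . A x = 0. Only positivity of the form is asked, so
  the matrices on the segment below qualify directly.\<close>

lemma invertible_if_inner_pos:
  fixes A :: "real ^ 'n ^ 'n"
  assumes "\<And>x. x \<noteq> 0 \<Longrightarrow> 0 < x \<bullet> (A *v x)"
  shows "invertible A"
proof -
  have "x = 0" if "A *v x = 0" for x
    using assms that by (metis inner_zero_right less_irrefl)
  then show ?thesis
    using invertible_left_inverse matrix_left_invertible_ker by blast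
qed

lemma pos_def_mat_invertible: "pos_def_mat A \<Longrightarrow> invertible A"
  by (simp add: pos_def_mat_def invertible_if_inner_pos)

text \<open>The segment from the identity to \<open>A\<close> consists of positive definite, hence invertible,
  matrices, so the determinant keeps its sign along it.\<close>

lemma pos_def_mat_det_pos:
  fixes A :: "real ^ 'n ^ 'n"
  assumes "pos_def_mat A"
  shows "0 < det A"
proof (rule ccontr)
  assume "\<not> 0 < det A"
  define B where "B t = (1 - t) *\<^sub>R mat 1 + t *\<^sub>R A" for t
  have nz: "det (B t) \<noteq> 0" if t: "0 \<le> t" "t \<le> 1" for t
  proof -
    have "0 < x \<bullet> (B t *v x)" if "x \<noteq> 0" for x
    proof -
      have Bx: "x \<bullet> (B t *v x) = (1 - t) * (x \<bullet> x) + t * (x \<bullet> (A *v x))"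
        by (simp add: B_def algebra_simps flip: scaleR_matrix_vector_assoc)
      have "0 < x \<bullet> x" "0 < x \<bullet> (A *v x)"
        using assms that by (auto simp: pos_def_mat_def)
      then show ?thesis
        unfolding Bx using t by (cases "t = 0") (auto intro!: add_nonneg_pos)
    qed
    then show ?thesis
      using invertible_if_inner_pos invertible_det_nz by metis
  qed
  have "continuous_on {0..1} (\<lambda>t. det (B t))"
    unfolding det_def B_def by (intro continuous_intros)
  moreover have "det (B 1) \<le> 0" "0 \<le> det (B 0)"
    using \<open>\<not> 0 < det A\<close> by (simp_all add: B_def)
  ultimately obtain t where "0 \<le> t" "t \<le> 1" "det (B t) = 0"
    using IVT2'[of "\<lambda>t. det (B t)" 1 0 0] by auto
  then show False
    using nz by blast
qed

text \<open>Writing x = A y turns the form of A^-1 at x into the form of A at y.\<close>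

lemma pos_def_mat_inner_inv_nonneg:
  assumes "pos_def_mat A"
  shows "0 \<le> x \<bullet> (matrix_inv A *v x)"
proof -
  let ?y = "matrix_inv A *v x"
  have "0 \<le> ?y \<bullet> (A *v ?y)"
    using assms by (cases "?y = 0") (auto simp: pos_def_mat_def less_imp_le)
  then show ?thesis
    by (simp add: matrix_inv_mult_vec[OF pos_def_mat_invertible[OF assms]] inner_commute)
qed

text \<open>\<open>R\<close> may be indefinite, so its own form says nothing; instead (det R)^2 =
  det A > 0.\<close>

lemma symmetric_sqrt_mat_invertible:
  assumes "pos_def_mat A" "symmetric_sqrt_mat A R"
  shows "invertible R"
proof -
  have "det R * det R = det A"
    using assms(2) by (auto simp: symmetric_sqrt_mat_def det_mul)
  then show ?thesis
    using pos_def_mat_det_pos[OF assms(1)] by (auto simp: invertible_det_nz)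
qed

section \<open>Block vectors and block matrices\<close>

lemma join_vec_nth [simp]:
  "join_vec u v $ Inl i = u $ i" "join_vec u v $ Inr j = v $ j"
  by (simp_all add: join_vec_def)

lemma all_Plus: "(\<forall>i. P i) \<longleftrightarrow> (\<forall>j. P (Inl j)) \<and> (\<forall>j. P (Inr j))"
  by (metis sum.exhaust)

lemma sum_UNIV_Plus: "(\<Sum>i\<in>UNIV. f i) = (\<Sum>j\<in>UNIV. f (Inl j)) + (\<Sum>j\<in>UNIV. f (Inr j))"
  for f :: "'m::finite + 'n::finite \<Rightarrow> 'a::comm_monoid_add"
  using sum.Plus[of UNIV UNIV f] by (simp add: comp_def)

lemma prod_UNIV_Plus: "(\<Prod>i\<in>UNIV. f i) = (\<Prod>j\<in>UNIV. f (Inl j)) * (\<Prod>j\<in>UNIV. f (Inr j))"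
  for f :: "'m::finite + 'n::finite \<Rightarrow> 'a::comm_monoid_mult"
  using prod.Plus[of UNIV UNIV f] by (simp add: comp_def)

lemma join_vec_cases:
  obtains u v where "x = join_vec u v"
proof
  show "x = join_vec (\<chi> i. x $ Inl i) (\<chi> i. x $ Inr i)"
    by (simp add: vec_eq_iff all_Plus)
qed

lemma join_vec_eq_iff [simp]: "join_vec u v = join_vec u' v' \<longleftrightarrow> u = u' \<and> v = v'"
  by (simp add: vec_eq_iff all_Plus)

lemma join_vec_eq_0_iff: "join_vec u v = 0 \<longleftrightarrow> u = 0 \<and> v = 0"
  by (simp add: vec_eq_iff all_Plus)

lemma join_vec_diff: "join_vec u v - join_vec u' v' = join_vec (u - u') (v - v')"
  by (simp add: vec_eq_iff all_Plus)

lemma inner_join_vec: "join_vec u v \<bullet> join_vec u' v' = u \<bullet> u' + v \<bullet> v'"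
  by (simp add: inner_vec_def sum_UNIV_Plus)

lemma block_mat_mult_join_vec:
  "block_mat A B C D *v join_vec u v = join_vec (A *v u + B *v v) (C *v u + D *v v)"
  by (simp add: vec_eq_iff all_Plus block_mat_def matrix_vector_mult_def sum_UNIV_Plus)

lemma transpose_block_mat:
  "transpose (block_mat A B C D) = block_mat (transpose A) (transpose C) (transpose B) (transpose D)"
  by (simp add: vec_eq_iff all_Plus block_mat_def transpose_def)

lemma transpose_add: "transpose (A + B) = transpose A + transpose B"
  by (simp add: vec_eq_iff transpose_def)

lemma vec_power_join_vec: "vec_power (join_vec u v) (join_vec k l) = vec_power u k * vec_power v l"
  by (simp add: vec_power_def prod_UNIV_Plus)

lemma trunc_box_join_vec:
  "join_vec u v \<in> trunc_box (join_vec a a') (join_vec b b') \<longleftrightarrow> u \<in> trunc_box a b \<and> v \<in> trunc_box a' b'"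
  by (auto simp: trunc_box_def all_Plus)

section \<open>The scale matrix of X and its inverse\<close>

context
  fixes \<Sigma> R :: "real ^ 'p ^ 'p" and \<Lambda> :: "real ^ 'q ^ 'p" and \<Psi> :: "real ^ 'q ^ 'q"
    and \<Omega> :: "real ^ ('q + 'p) ^ ('q + 'p)"
  defines "\<Omega> \<equiv> block_mat (\<Psi> + transpose \<Lambda> ** \<Lambda>) (transpose (R ** \<Lambda>)) (R ** \<Lambda>) \<Sigma>"
  assumes \<Sigma>: "pos_def_mat \<Sigma>" and R: "symmetric_sqrt_mat \<Sigma> R" and \<Psi>: "pos_def_mat \<Psi>"
begin

text \<open>\<Omega> is the sum of diag(\<Psi>, 0) and G^T G with G = (\<Lambda>, R). Outside the
  term \<Psi> u everything passes through w = \<Lambda> u + R v, which makes both the quadratic form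
  and the inverse easy to find.\<close>

lemma scale_mult_join_vec:
  "\<Omega> *v join_vec u v =
    join_vec (\<Psi> *v u + transpose \<Lambda> *v (\<Lambda> *v u + R *v v)) (R *v (\<Lambda> *v u + R *v v))"
  using R unfolding symmetric_sqrt_mat_def
  by (auto simp: \<Omega>_def block_mat_mult_join_vec matrix_transpose_mul matrix_vector_mult_add_rdistrib
      matrix_vector_right_distrib matrix_vector_mul_assoc)

text \<open>The form at (u, v) is u . \<Psi> u + |w|^2 with w = \<Lambda> u + R v. If u = 0, then w
  = R v, which is nonzero for nonzero v because R is invertible.\<close>

lemma scale_pos_def: "pos_def_mat \<Omega>"
proof -
  have tR: "transpose R = R"
    using R by (simp add: symmetric_sqrt_mat_def)
  have "0 < x \<bullet> (\<Omega> *v x)" if "x \<noteq> 0" for x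
  proof -
    obtain u v where x: "x = join_vec u v"
      by (rule join_vec_cases)
    let ?w = "\<Lambda> *v u + R *v v"
    have "u \<bullet> (transpose \<Lambda> *v ?w) = (\<Lambda> *v u) \<bullet> ?w"
      using inner_transpose_mult[of \<Lambda> ?w u] by (metis inner_commute)
    then have eq: "x \<bullet> (\<Omega> *v x) = u \<bullet> (\<Psi> *v u) + ?w \<bullet> ?w"
      using inner_symmetric_mult[OF tR, of v ?w]
      by (simp add: x scale_mult_join_vec inner_join_vec inner_right_distrib inner_left_distrib)
    show ?thesis
    proof (cases "u = 0")
      case True
      then have "v \<noteq> 0"
        using that x by (auto simp: join_vec_eq_0_iff)
      then have "R *v v \<noteq> 0"
        using matrix_inv_mult_vec(2)[OF symmetric_sqrt_mat_invertible[OF \<Sigma> R], of v] by auto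
      then show ?thesis
        using True by (simp add: eq)
    next
      case False
      then show ?thesis
        unfolding eq using \<Psi> by (intro add_pos_nonneg) (auto simp: pos_def_mat_def)
    qed
  qed
  moreover have "transpose (transpose \<Lambda> ** \<Lambda>) = transpose \<Lambda> ** \<Lambda>"
    by (simp add: matrix_transpose_mul)
  then have "transpose \<Omega> = \<Omega>"
    using \<Sigma> \<Psi> by (simp add: \<Omega>_def transpose_block_mat pos_def_mat_def transpose_add)
  ultimately show ?thesis
    by (simp add: pos_def_mat_def)
qed

text \<open>The system \<Omega> (u', v') = (u, v) is solved by hand: its second block forces
  \<Lambda> u' + R v' = R^-1 v, and then the first leaves \<Psi> u' = u - m v.\<close>

lemma inner_scale_inv_join_vec:
  defines "m \<equiv> \<lambda>v. transpose \<Lambda> *v (matrix_inv R *v v)"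
  shows "join_vec u v \<bullet> (matrix_inv \<Omega> *v join_vec u v) =
    v \<bullet> (matrix_inv \<Sigma> *v v) + (u - m v) \<bullet> (matrix_inv \<Psi> *v (u - m v))"
proof -
  have invR: "invertible R"
    by (rule symmetric_sqrt_mat_invertible[OF \<Sigma> R])
  have tR: "transpose R = R"
    using R by (simp add: symmetric_sqrt_mat_def)
  define u' where "u' = matrix_inv \<Psi> *v (u - m v)"
  \<comment> \<open>This is R^-1 (R^-1 v - \<Lambda> u'), since \<Sigma>^-1 = R^-1 R^-1.\<close>
  define v' where "v' = matrix_inv \<Sigma> *v v - matrix_inv R *v (\<Lambda> *v u')"
  have \<Sigma>inv: "R *v (matrix_inv \<Sigma> *v v) = matrix_inv R *v v"
  proof -
    have "R *v (R *v (matrix_inv \<Sigma> *v v)) = v"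
      using R matrix_inv_mult_vec(1)[OF pos_def_mat_invertible[OF \<Sigma>], of v]
      by (auto simp: symmetric_sqrt_mat_def matrix_vector_mul_assoc matrix_mul_assoc)
    then show ?thesis
      by (metis matrix_inv_mult_vec(2)[OF invR])
  qed
  have w: "\<Lambda> *v u' + R *v v' = matrix_inv R *v v"
    by (simp add: v'_def matrix_vector_mult_diff_distrib \<Sigma>inv matrix_inv_mult_vec[OF invR])
  have "\<Omega> *v join_vec u' v' = join_vec u v"
    unfolding scale_mult_join_vec w
    by (simp add: u'_def m_def matrix_inv_mult_vec[OF invR]
        matrix_inv_mult_vec[OF pos_def_mat_invertible[OF \<Psi>]])
  then have "matrix_inv \<Omega> *v join_vec u v = join_vec u' v'"
    using matrix_inv_mult_vec(2)[OF pos_def_mat_invertible[OF scale_pos_def], of "join_vec u' v'"] by simp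
  \<comment> \<open>The cross term of v . v' is m v . u', which combines with u . u' into (u - m v)
    . u'.\<close>
  moreover have "v \<bullet> (matrix_inv R *v (\<Lambda> *v u')) = m v \<bullet> u'"
    by (simp add: m_def inner_transpose_mult inner_matrix_inv_symmetric[OF invR tR] del: transpose_matrix_vector)
  ultimately show ?thesis
    by (simp add: inner_join_vec v'_def inner_diff_left inner_diff_right flip: u'_def)
qed

end

section \<open>The multivariate Student density\<close>

lemma mahalanobis2_nonneg: "pos_def_mat \<Omega> \<Longrightarrow> 0 \<le> mahalanobis2 \<xi> \<Omega> x"
  by (simp add: mahalanobis2_def pos_def_mat_inner_inv_nonneg)

lemma borel_measurable_mahalanobis2 [measurable]: "mahalanobis2 \<xi> \<Omega> \<in> borel_measurable borel"
proof -
  have "continuous_on UNIV (mahalanobis2 \<xi> \<Omega>)"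
    unfolding mahalanobis2_def
    by (intro continuous_intros bounded_linear.continuous_on[OF matrix_vector_mul_bounded_linear])
  then show ?thesis
    by (rule borel_measurable_continuous_onI)
qed

lemma borel_measurable_t_density [measurable]: "t_density \<xi> \<Omega> \<nu> \<in> borel_measurable borel"
  unfolding t_density_def[abs_def] by measurable

text \<open>The value at the location carries the whole normalising constant, so Gamma factors and
  determinants never have to be compared.\<close>

lemma t_density_eq_mode:
  "t_density \<xi> \<Omega> \<nu> x = t_density \<xi> \<Omega> \<nu> \<xi> *
    (1 + mahalanobis2 \<xi> \<Omega> x / \<nu>) powr (- ((\<nu> + real CARD('n)) / 2))"
  for \<xi> :: "real ^ 'n"
  by (simp add: t_density_def mahalanobis2_def)

lemma t_density_pos:
  assumes "pos_def_mat \<Omega>" "0 < \<nu>"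
  shows "0 < t_density \<xi> \<Omega> \<nu> x"
proof -
  have "0 < 1 + mahalanobis2 \<xi> \<Omega> x / \<nu>"
    using assms mahalanobis2_nonneg[OF assms(1), of \<xi> x] by (simp add: add_pos_nonneg)
  moreover have "0 < Gamma ((\<nu> + real CARD('a)) / 2)" "0 < Gamma (\<nu> / 2)"
    using assms(2) by (auto intro!: Gamma_real_pos)
  ultimately show ?thesis
    unfolding t_density_def using assms(2) pos_def_mat_det_pos[OF assms(1)]
    by (intro mult_pos_pos divide_pos_pos) (auto simp: powr_gt_zero)
qed

text \<open>With d and e the forms in y - \<mu> and x - m y, the base 1 + (d + e)/\<nu> is a product
  of the bases of the two smaller densities. \<open>A\<close> is independent of x and y; r y ^ q is
  kept apart as the Jacobian of x \<mapsto> r y (m y - x). The argument m y - x has the sign that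
  turns x \<ge> 0 into an upper bound, as a distribution function requires.\<close>

lemma t_density_join_vec_factor:
  fixes \<mu> :: "real ^ 'p" and \<Sigma> R :: "real ^ 'p ^ 'p" and \<Lambda> :: "real ^ 'q ^ 'p"
    and \<tau> :: "real ^ 'q" and \<Psi> :: "real ^ 'q ^ 'q" and \<nu> :: real
  defines "\<xi> \<equiv> join_vec \<tau> \<mu>"
    and "\<Omega> \<equiv> block_mat (\<Psi> + transpose \<Lambda> ** \<Lambda>) (transpose (R ** \<Lambda>)) (R ** \<Lambda>) \<Sigma>"
    and "m \<equiv> \<lambda>y. \<tau> + transpose \<Lambda> *v (matrix_inv R *v (y - \<mu>))"
    and "r \<equiv> \<lambda>y. sqrt ((\<nu> + real CARD('p)) / (\<nu> + mahalanobis2 \<mu> \<Sigma> y))"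
  assumes \<nu>: "0 < \<nu>" and \<Sigma>: "pos_def_mat \<Sigma>" and R: "symmetric_sqrt_mat \<Sigma> R"
    and \<Psi>: "pos_def_mat \<Psi>"
  obtains A where "0 < A"
    and "\<And>x y. t_density \<xi> \<Omega> \<nu> (join_vec x y) =
      A * t_density \<mu> \<Sigma> \<nu> y *
      (r y ^ CARD('q) * t_density 0 \<Psi> (\<nu> + real CARD('p)) (r y *\<^sub>R (m y - x)))"
proof
  let ?p = "real CARD('p)" and ?q = "real CARD('q)"
  have \<Omega>: "pos_def_mat \<Omega>"
    unfolding \<Omega>_def by (rule scale_pos_def[OF \<Sigma> R \<Psi>])
  define a b c where "a = t_density \<xi> \<Omega> \<nu> \<xi>" and "b = t_density \<mu> \<Sigma> \<nu> \<mu>"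
    and "c = t_density 0 \<Psi> (\<nu> + ?p) 0"
  have abc: "0 < a" "0 < b" "0 < c"
    using \<nu> \<Omega> \<Sigma> \<Psi> by (auto simp: a_def b_def c_def intro!: t_density_pos)
  \<comment> \<open>The ratio of the values at the modes, times the constant that relates r y ^ q to
    (1 + d/\<nu>)^(-q/2).\<close>
  define A where "A = a / (b * c) * (\<nu> / (\<nu> + ?p)) powr (?q / 2)"
  show "0 < A"
    using abc \<nu> by (simp add: A_def)
  fix x y
  define d where "d = mahalanobis2 \<mu> \<Sigma> y"
  define e where "e = (x - m y) \<bullet> (matrix_inv \<Psi> *v (x - m y))"
  define s where "s = (\<nu> + ?p) / (\<nu> + d)"
  have d: "0 \<le> d" and e: "0 \<le> e" and s: "0 < s"
    using \<nu> mahalanobis2_nonneg[OF \<Sigma>] pos_def_mat_inner_inv_nonneg[OF \<Psi>]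
    by (auto simp: d_def e_def s_def add_pos_nonneg)
  have r: "r y = sqrt s"
    by (simp add: r_def s_def d_def)
  have "x - \<tau> - transpose \<Lambda> *v (matrix_inv R *v (y - \<mu>)) = x - m y"
    by (simp add: m_def)
  then have "mahalanobis2 \<xi> \<Omega> (join_vec x y) = d + e"
    unfolding mahalanobis2_def d_def e_def \<xi>_def \<Omega>_def join_vec_diff
    by (simp only: inner_scale_inv_join_vec[OF \<Sigma> R \<Psi>])
  then have t\<Omega>: "t_density \<xi> \<Omega> \<nu> (join_vec x y) =
      a * (1 + (d + e) / \<nu>) powr (- ((\<nu> + ?q + ?p) / 2))"
    by (subst t_density_eq_mode) (simp add: a_def add.assoc)
  have t\<Sigma>: "t_density \<mu> \<Sigma> \<nu> y = b * (1 + d / \<nu>) powr (- ((\<nu> + ?p) / 2))"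
    by (subst t_density_eq_mode) (simp add: b_def d_def)
  have "mahalanobis2 0 \<Psi> (r y *\<^sub>R (m y - x)) = r y * (r y * ((m y - x) \<bullet> (matrix_inv \<Psi> *v (m y - x))))"
    by (simp add: mahalanobis2_def matrix_vector_mult_scaleR)
  \<comment> \<open>The form is even, so m y - x may be exchanged for x - m y.\<close>
  also have "\<dots> = s * e"
    using s by (simp add: r e_def matrix_vector_mult_diff_distrib inner_diff_left inner_diff_right flip: mult.assoc)
  finally have t\<Psi>: "t_density 0 \<Psi> (\<nu> + ?p) (r y *\<^sub>R (m y - x)) =
      c * (1 + s * e / (\<nu> + ?p)) powr (- ((\<nu> + ?p + ?q) / 2))"
    by (subst t_density_eq_mode) (simp add: c_def)
  have pos: "0 < 1 + d / \<nu>" "0 < 1 + s * e / (\<nu> + ?p)"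
    using \<nu> d e s by (auto intro!: add_pos_nonneg)
  have "1 + (d + e) / \<nu> = (1 + d / \<nu>) * (1 + s * e / (\<nu> + ?p))"
  proof -
    have "s * e / (\<nu> + ?p) = e / (\<nu> + d)"
      using \<nu> by (simp add: s_def)
    moreover have "1 + (d + e) / \<nu> = (1 + d / \<nu>) * (1 + e / (\<nu> + d))"
      using \<nu> d by (simp add: divide_simps)
    ultimately show ?thesis
      by simp
  qed
  then have "(1 + (d + e) / \<nu>) powr (- ((\<nu> + ?q + ?p) / 2)) =
      (1 + d / \<nu>) powr (- ((\<nu> + ?q + ?p) / 2)) * (1 + s * e / (\<nu> + ?p)) powr (- ((\<nu> + ?q + ?p) / 2))"
    by (simp only: powr_mult)
  \<comment> \<open>The first part is the exponent of the t_p density; the surplus -q/2 is what r y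
    ^ q accounts for.\<close>
  moreover have "- ((\<nu> + ?q + ?p) / 2) = - ((\<nu> + ?p) / 2) + - (?q / 2)"
    by (simp add: field_simps)
  then have "(1 + d / \<nu>) powr (- ((\<nu> + ?q + ?p) / 2)) =
      (1 + d / \<nu>) powr (- ((\<nu> + ?p) / 2)) * (1 + d / \<nu>) powr (- (?q / 2))"
    by (simp only: powr_add)
  ultimately have split: "(1 + (d + e) / \<nu>) powr (- ((\<nu> + ?q + ?p) / 2)) =
      (1 + d / \<nu>) powr (- ((\<nu> + ?p) / 2)) * (1 + d / \<nu>) powr (- (?q / 2)) *
      (1 + s * e / (\<nu> + ?p)) powr (- ((\<nu> + ?p + ?q) / 2))"
    by (simp add: add_ac)
  have "r y ^ CARD('q) = s powr (?q / 2)"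
    using s by (simp add: r powr_half_sqrt[symmetric] powr_powr flip: powr_realpow)
  \<comment> \<open>Reciprocals are written as powers so that the laws for \<open>powr\<close>
    distribute the exponent q/2.\<close>
  also have "s = (\<nu> / (\<nu> + ?p)) powr (-1) * (1 + d / \<nu>) powr (-1)"
    using \<nu> d by (simp add: s_def powr_minus divide_simps)
  also have "\<dots> powr (?q / 2) = (\<nu> / (\<nu> + ?p)) powr (- (?q / 2)) * (1 + d / \<nu>) powr (- (?q / 2))"
    by (simp only: powr_mult powr_powr mult_minus1)
  finally have "(\<nu> / (\<nu> + ?p)) powr (?q / 2) * r y ^ CARD('q) = (1 + d / \<nu>) powr (- (?q / 2))"
    using \<nu> by (simp add: powr_minus)
  then show "t_density \<xi> \<Omega> \<nu> (join_vec x y) =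
      A * t_density \<mu> \<Sigma> \<nu> y * (r y ^ CARD('q) * t_density 0 \<Psi> (\<nu> + ?p) (r y *\<^sub>R (m y - x)))"
    using abc unfolding t\<Omega> t\<Sigma> t\<Psi> split A_def by (simp add: field_simps)
qed

section \<open>Lebesgue measure\<close>

lemma measurable_join_vec:
  "(\<lambda>(u, v). join_vec u v :: real ^ ('m::finite + 'n::finite)) \<in> borel_measurable (borel \<Otimes>\<^sub>M borel)"
proof -
  have "continuous_on UNIV (\<lambda>(u, v). join_vec u v :: real ^ ('m::finite + 'n::finite))"
    unfolding join_vec_def case_prod_beta'
  proof (intro continuous_on_vec_lambda)
    fix i :: "'m + 'n"
    show "continuous_on UNIV (\<lambda>p :: (real ^ 'm) \<times> (real ^ 'n).
        case i of Inl j \<Rightarrow> fst p $ j | Inr j \<Rightarrow> snd p $ j)"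
      by (cases i) (auto intro!: continuous_intros)
  qed
  then show ?thesis
    by (subst borel_prod) (rule borel_measurable_continuous_onI)
qed

lemma borel_measurable_join_vec [measurable (raw)]:
  fixes f :: "'a \<Rightarrow> real ^ 'm" and g :: "'a \<Rightarrow> real ^ 'n"
  assumes [measurable]: "f \<in> borel_measurable M" "g \<in> borel_measurable M"
  shows "(\<lambda>x. join_vec (f x) (g x)) \<in> borel_measurable M"
proof -
  have "(\<lambda>x. (f x, g x)) \<in> M \<rightarrow>\<^sub>M borel \<Otimes>\<^sub>M borel"
    by measurable
  from measurable_compose[OF this measurable_join_vec] show ?thesis
    by simp
qed

lemma emeasure_lborel_box_cart:
  fixes l u :: "real ^ 'n"
  assumes "\<And>i. l $ i \<le> u $ i"
  shows "emeasure lborel (box l u) = (\<Prod>i\<in>UNIV. u $ i - l $ i)"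
proof -
  have "(\<Prod>b\<in>Basis. (u - l) \<bullet> b) = (\<Prod>i\<in>UNIV. u $ i - l $ i)"
    by (subst prod.reindex_bij_witness[of _ "\<lambda>i. axis i 1" "\<lambda>b. SOME i. b = axis i 1"])
      (auto simp: Basis_vec_def inner_axis axis_eq_axis)
  moreover have "l \<bullet> b \<le> u \<bullet> b" if "b \<in> Basis" for b
    using assms that by (auto simp: Basis_vec_def inner_axis)
  ultimately show ?thesis
    by (simp add: emeasure_lborel_box)
qed

text \<open>Lebesgue measure is determined by its values on boxes, and a box in the joined space
  pulls back to a product of two boxes.\<close>

lemma lborel_eq_distr_join_vec:
  "(lborel :: (real ^ ('m::finite + 'n::finite)) measure) =
    distr (lborel \<Otimes>\<^sub>M lborel) borel (\<lambda>(u, v). join_vec u v)"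
proof (rule lborel_eqI)
  fix l u :: "real ^ ('m::finite + 'n::finite)"
  assume le: "\<And>b. b \<in> Basis \<Longrightarrow> l \<bullet> b \<le> u \<bullet> b"
  obtain l1 l2 u1 u2 where l: "l = join_vec l1 l2" and u: "u = join_vec u1 u2"
    by (metis join_vec_cases)
  have lu: "l $ i \<le> u $ i" for i
    using le[of "axis i 1"] by (simp add: inner_axis axis_in_Basis_iff)
  have "(\<lambda>(x, y). join_vec x y) -` box l u = box l1 u1 \<times> box l2 u2"
    by (auto simp: mem_box_cart all_Plus l u)
  then have "emeasure (distr (lborel \<Otimes>\<^sub>M lborel) borel (\<lambda>(x, y). join_vec x y)) (box l u) =
      emeasure lborel (box l1 u1) * emeasure lborel (box l2 u2)"
    by (simp add: emeasure_distr space_pair_measure lborel.emeasure_pair_measure_Times)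
  also have "\<dots> = (\<Prod>i\<in>UNIV. u $ i - l $ i)"
    using lu[of "Inl _"] lu[of "Inr _"]
    by (simp add: emeasure_lborel_box_cart prod_UNIV_Plus l u prod_nonneg flip: ennreal_mult)
  also have "\<dots> = (\<Prod>b\<in>Basis. (u - l) \<bullet> b)"
    using emeasure_lborel_box_cart[OF lu] emeasure_lborel_box[OF le] by simp
  finally show "emeasure (distr (lborel \<Otimes>\<^sub>M lborel) borel (\<lambda>(x, y). join_vec x y)) (box l u) =
      (\<Prod>b\<in>Basis. (u - l) \<bullet> b)" .
qed simp

text \<open>Tonelli, with the first block integrated inside: the block X_1 is to be integrated out
  at a fixed value of X_2.\<close>

lemma nn_integral_lborel_join_vec:
  fixes f :: "real ^ ('m::finite + 'n::finite) \<Rightarrow> ennreal"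
  assumes [measurable]: "f \<in> borel_measurable borel"
  shows "(\<integral>\<^sup>+x. f x \<partial>lborel) = (\<integral>\<^sup>+v. \<integral>\<^sup>+u. f (join_vec u v) \<partial>lborel \<partial>lborel)"
proof -
  have "(\<integral>\<^sup>+x. f x \<partial>lborel) = (\<integral>\<^sup>+p. f (case p of (u, v) \<Rightarrow> join_vec u v) \<partial>(lborel \<Otimes>\<^sub>M lborel))"
    by (subst lborel_eq_distr_join_vec, subst nn_integral_distr) auto
  then show ?thesis
    using lborel_pair.nn_integral_snd[of "\<lambda>p. f (case p of (u, v) \<Rightarrow> join_vec u v)"] by simp
qed

text \<open>The sign of \<open>c\<close> is left free because the substitution to come reflects the
  space.\<close>

lemma nn_integral_lborel_affine:
  fixes f :: "'a::euclidean_space \<Rightarrow> ennreal"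
  assumes [measurable]: "f \<in> borel_measurable borel" and "c \<noteq> 0"
  shows "(\<integral>\<^sup>+x. f x \<partial>lborel) = \<bar>c\<bar> ^ DIM('a) * (\<integral>\<^sup>+x. f (t + c *\<^sub>R x) \<partial>lborel)"
  by (subst lborel_affine[OF \<open>c \<noteq> 0\<close>, of t])
    (simp add: nn_integral_density nn_integral_distr nn_integral_cmult ennreal_power)

section \<open>Projection, monomials and truncation boxes\<close>

text \<open>Applied to X = (X_1, X_2), this is X_2.\<close>

definition lower_vec :: "'a ^ ('m::finite + 'n::finite) \<Rightarrow> 'a ^ 'n" where
  "lower_vec x = (\<chi> i. x $ Inr i)"

lemma lower_vec_join_vec [simp]: "lower_vec (join_vec u v) = v"
  by (simp add: lower_vec_def vec_eq_iff)

lemma borel_measurable_lower_vec [measurable]: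
  "(lower_vec :: real ^ ('m::finite + 'n::finite) \<Rightarrow> _) \<in> borel_measurable borel"
  unfolding lower_vec_def by (intro borel_measurable_continuous_onI continuous_intros)

lemma borel_measurable_vec_power [measurable]:
  "(\<lambda>x. vec_power x k) \<in> borel_measurable borel"
  unfolding vec_power_def by (intro borel_measurable_continuous_onI continuous_intros)

lemma sets_trunc_box [measurable]: "trunc_box a b \<in> sets borel"
proof -
  have nth: "(\<lambda>x. ereal (x $ i)) \<in> borel_measurable borel" for i :: 'a
    by (intro borel_measurable_ereal borel_measurable_continuous_onI continuous_intros)
  have "trunc_box a b =
      (\<Inter>i. {x \<in> space borel. a $ i \<le> ereal (x $ i)} \<inter> {x \<in> space borel. ereal (x $ i) \<le> b $ i})"
    by (auto simp: trunc_box_def)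
  also have "\<dots> \<in> sets borel"
    using nth by (intro sets.finite_INT sets.Int borel_measurable_le) auto
  finally show ?thesis .
qed

text \<open>These are the limits that \<alpha> and \<beta> place on X_1.\<close>

lemma trunc_box_nonneg: "trunc_box 0 (\<chi> i. \<infinity>) = {0..}"
  by (auto simp: trunc_box_def less_eq_vec_def zero_ereal_def)

lemma sets_orthant [measurable]:
  fixes z :: "real ^ 'n"
  shows "{z..} \<in> sets borel" "{..z} \<in> sets borel"
  unfolding atLeast_def atMost_def less_eq_vec_def
  by (auto intro!: borel_closed closed_Collect_all closed_Collect_le continuous_intros)

section \<open>The Student distribution on the orthant\<close>

text \<open>No normalising constant of \<open>t\<^sub>q\<close> needs to be computed: its density has finite mass
  because \<open>X\<close> has a probability density that factors through it.\<close>

lemma orthant_integral_t_density: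
  fixes \<mu> :: "real ^ 'p" and \<Sigma> R :: "real ^ 'p ^ 'p" and \<Lambda> :: "real ^ 'q ^ 'p"
    and \<tau> :: "real ^ 'q" and \<Psi> :: "real ^ 'q ^ 'q" and \<nu> :: real
  defines "\<xi> \<equiv> join_vec \<tau> \<mu>"
    and "\<Omega> \<equiv> block_mat (\<Psi> + transpose \<Lambda> ** \<Lambda>) (transpose (R ** \<Lambda>)) (R ** \<Lambda>) \<Sigma>"
    and "m \<equiv> \<lambda>y. \<tau> + transpose \<Lambda> *v (matrix_inv R *v (y - \<mu>))"
    and "r \<equiv> \<lambda>y. sqrt ((\<nu> + real CARD('p)) / (\<nu> + mahalanobis2 \<mu> \<Sigma> y))"
  assumes \<nu>: "0 < \<nu>" and \<Sigma>: "pos_def_mat \<Sigma>" and R: "symmetric_sqrt_mat \<Sigma> R"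
    and \<Psi>: "pos_def_mat \<Psi>"
    and total: "(\<integral>\<^sup>+x. ennreal (t_density \<xi> \<Omega> \<nu> x) \<partial>lborel) = 1"
  obtains A where "0 < A"
    and "\<And>y. (\<integral>\<^sup>+x. ennreal (t_density \<xi> \<Omega> \<nu> (join_vec x y)) * indicator {0..} x \<partial>lborel) =
      ennreal (A * (t_density \<mu> \<Sigma> \<nu> y * t_cdf \<Psi> (\<nu> + real CARD('p)) (r y *\<^sub>R m y)))"
proof -
  let ?p = "real CARD('p)"
  obtain A where A: "0 < A" and factor: "\<And>x y. t_density \<xi> \<Omega> \<nu> (join_vec x y) =
      A * t_density \<mu> \<Sigma> \<nu> y *
      (r y ^ CARD('q) * t_density 0 \<Psi> (\<nu> + ?p) (r y *\<^sub>R (m y - x)))"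
    using t_density_join_vec_factor[OF \<nu> \<Sigma> R \<Psi>, of \<tau> \<mu> \<Lambda>] unfolding \<xi>_def \<Omega>_def m_def r_def
    by blast
  let ?t = "t_density 0 \<Psi> (\<nu> + ?p)"
  have t_pos: "0 < ?t x" "0 < t_density \<mu> \<Sigma> \<nu> y" for x y
    using \<nu> \<Sigma> \<Psi> by (auto intro!: t_density_pos)
  have r: "0 < r y" for y
    using \<nu> mahalanobis2_nonneg[OF \<Sigma>, of \<mu> y] by (simp add: r_def add_pos_nonneg)
  \<comment> \<open>Substituting u = r y (m y - x) produces the Jacobian r y ^ q, which is exactly
    the factor split off above. The weight \<open>g\<close> is 1 for the finiteness argument and an
    indicator for the distribution function.\<close>
  have fibre: "(\<integral>\<^sup>+x. ennreal (t_density \<xi> \<Omega> \<nu> (join_vec x y)) * g (r y *\<^sub>R (m y - x)) \<partial>lborel) =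
      ennreal (A * t_density \<mu> \<Sigma> \<nu> y) * (\<integral>\<^sup>+u. ennreal (?t u) * g u \<partial>lborel)"
    if [measurable]: "g \<in> borel_measurable borel" for g y
  proof -
    have "(\<integral>\<^sup>+u. ennreal (?t u) * g u \<partial>lborel) =
        ennreal (r y ^ CARD('q)) * (\<integral>\<^sup>+x. ennreal (?t (r y *\<^sub>R (m y - x))) * g (r y *\<^sub>R (m y - x)) \<partial>lborel)"
      using r[of y] nn_integral_lborel_affine[of "\<lambda>u. ennreal (?t u) * g u" "- r y" "r y *\<^sub>R m y"]
      by (simp add: scaleR_diff_right ennreal_power)
    then show ?thesis
      using A r[of y] t_pos
      by (simp add: factor ennreal_mult mult.assoc nn_integral_cmult less_imp_le)
  qed
  have finite: "(\<integral>\<^sup>+u. ennreal (?t u) \<partial>lborel) \<noteq> \<infinity>"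
  proof
    assume inf: "(\<integral>\<^sup>+u. ennreal (?t u) \<partial>lborel) = \<infinity>"
    \<comment> \<open>Infinite mass of the t_q factor would make every fibre integral infinite,
      hence also the total mass of X.\<close>
    have "(\<integral>\<^sup>+x. ennreal (t_density \<xi> \<Omega> \<nu> (join_vec x y)) \<partial>lborel) = \<infinity>" for y
      using fibre[of "\<lambda>_. 1" y] A t_pos(2)[of y] by (simp add: inf ennreal_mult_top)
    then have "(\<integral>\<^sup>+x. ennreal (t_density \<xi> \<Omega> \<nu> x) \<partial>lborel) = \<infinity>"
      by (subst nn_integral_lborel_join_vec) (auto simp: ennreal_top_mult)
    then show False
      using total by simp
  qed
  \<comment> \<open>\<open>measure\<close> is 0 where \<open>emeasure\<close> is infinite, so the
    passage to an integral rests on \<open>finite\<close>.\<close>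
  have cdf: "ennreal (t_cdf \<Psi> (\<nu> + ?p) z) = (\<integral>\<^sup>+u. ennreal (?t u) * indicator {..z} u \<partial>lborel)" for z
  proof -
    have "(\<integral>\<^sup>+u. ennreal (?t u) * indicator {..z} u \<partial>lborel) \<le> (\<integral>\<^sup>+u. ennreal (?t u) \<partial>lborel)"
      by (intro nn_integral_mono) (auto split: split_indicator)
    then have "(\<integral>\<^sup>+u. ennreal (?t u) * indicator {..z} u \<partial>lborel) \<noteq> \<infinity>"
      using finite by (auto simp: top_unique)
    then show ?thesis
      by (simp add: t_cdf_def measure_def emeasure_density less_top flip: atMost_def)
  qed
  \<comment> \<open>As r y > 0, the bound r y (m y - x) \<le> r y m y says x \<ge> 0.\<close>
  have "indicator {..r y *\<^sub>R m y} (r y *\<^sub>R (m y - x)) = (indicator {0..} x :: ennreal)" for x y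
    using r[of y] by (simp add: less_eq_vec_def indicator_def right_diff_distrib zero_le_mult_iff)
  then have "(\<integral>\<^sup>+x. ennreal (t_density \<xi> \<Omega> \<nu> (join_vec x y)) * indicator {0..} x \<partial>lborel) =
      ennreal (A * (t_density \<mu> \<Sigma> \<nu> y * t_cdf \<Psi> (\<nu> + ?p) (r y *\<^sub>R m y)))" for y
    using fibre[of "indicator {..r y *\<^sub>R m y}" y] A t_pos(2)[of y]
    by (simp add: ennreal_mult t_cdf_def less_imp_le mult.assoc flip: cdf)
  with A show thesis
    by (rule that)
qed

text \<open>Integrating X_1 over the orthant leaves a constant multiple of the SUT density, which is
  then integrated over S. All Borel sets S are covered, so that whole laws, not just box
  probabilities, can be compared.\<close>

lemma sut_law_proportional:
  fixes \<mu> :: "real ^ 'p" and \<Sigma> R :: "real ^ 'p ^ 'p" and \<Lambda> :: "real ^ 'q ^ 'p"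
    and \<tau> :: "real ^ 'q" and \<Psi> :: "real ^ 'q ^ 'q" and \<nu> :: real
    and M :: "'m measure" and Y :: "'m \<Rightarrow> real ^ 'p"
    and N :: "'n measure" and X :: "'n \<Rightarrow> real ^ ('q + 'p)"
  defines "\<xi> \<equiv> join_vec \<tau> \<mu>"
    and "\<Omega> \<equiv> block_mat (\<Psi> + transpose \<Lambda> ** \<Lambda>) (transpose (R ** \<Lambda>)) (R ** \<Lambda>) \<Sigma>"
  assumes \<nu>: "0 < \<nu>" and \<Sigma>: "pos_def_mat \<Sigma>" and R: "symmetric_sqrt_mat \<Sigma> R"
    and \<Psi>: "pos_def_mat \<Psi>"
    and M: "prob_space M" and Y: "sut_distributed M Y \<mu> \<Sigma> R \<Lambda> \<tau> \<nu> \<Psi>"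
    and N: "prob_space N" and X: "t_distributed N X \<xi> \<Omega> \<nu>"
  obtains c where "0 < c"
    and "\<And>S. S \<in> sets borel \<Longrightarrow>
      emeasure N (X -` {join_vec x y | x y. 0 \<le> x \<and> y \<in> S} \<inter> space N) =
      ennreal c * emeasure M (Y -` S \<inter> space M)"
proof -
  let ?f = "\<lambda>x. ennreal (t_density \<xi> \<Omega> \<nu> x)" and ?g = "sut_density \<mu> \<Sigma> R \<Lambda> \<tau> \<nu> \<Psi>"
  note dY = Y[unfolded sut_distributed_def] and dX = X[unfolded t_distributed_def]
  note [measurable] = distributed_borel_measurable[OF dY, simplified]
  have "(\<integral>\<^sup>+x. ?f x \<partial>lborel) = 1"
    using distributed_emeasure[OF dX, of UNIV] prob_space.emeasure_space_1[OF N] by simp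
  from orthant_integral_t_density[OF \<nu> \<Sigma> R \<Psi>, of \<tau> \<mu> \<Lambda>, folded \<xi>_def \<Omega>_def, OF this]
  obtain A where A: "0 < A" and orthant: "\<And>y. (\<integral>\<^sup>+x. ?f (join_vec x y) * indicator {0..} x \<partial>lborel) =
      ennreal (A * (t_density \<mu> \<Sigma> \<nu> y * t_cdf \<Psi> (\<nu> + real CARD('p))
        (sqrt ((\<nu> + real CARD('p)) / (\<nu> + mahalanobis2 \<mu> \<Sigma> y)) *\<^sub>R
          (\<tau> + transpose \<Lambda> *v (matrix_inv R *v (y - \<mu>))))))"
    by blast
  define D where "D = t_cdf (\<Psi> + transpose \<Lambda> ** \<Lambda>) \<nu> \<tau>"
  \<comment> \<open>Division by 0 gives 0, so D = 0 would make the density of Y vanish identically,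
    although Y has total mass 1.\<close>
  have "D \<noteq> 0"
  proof
    assume "D = 0"
    then have "?g y = 0" for y
      by (simp add: sut_density_def D_def)
    then have "emeasure M (space M) = 0"
      using distributed_emeasure[OF dY, of UNIV] by simp
    then show False
      using prob_space.emeasure_space_1[OF M] by simp
  qed
  then have D: "0 < D"
    unfolding D_def t_cdf_def by (simp add: zero_less_measure_iff)
  show thesis
  proof (rule that)
    show "0 < A * D"
      using A D by simp
    fix S :: "(real ^ 'p) set"
    assume S [measurable]: "S \<in> sets borel"
    let ?B = "{join_vec x y :: real ^ ('q + 'p) | x y. 0 \<le> x \<and> y \<in> S}"
    \<comment> \<open>Only the first block is constrained here; the description serves the
      measurability of \<open>?B\<close>.\<close>
    let ?T = "trunc_box (join_vec 0 (\<chi> i. - \<infinity>)) (join_vec (\<chi> i. \<infinity>) (\<chi> i. \<infinity>))"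
    have "?B = ?T \<inter> lower_vec -` S"
    proof (rule set_eqI)
      fix z :: "real ^ ('q + 'p)"
      obtain x y where z: "z = join_vec x y"
        by (rule join_vec_cases)
      show "z \<in> ?B \<longleftrightarrow> z \<in> ?T \<inter> lower_vec -` S"
        by (simp add: z trunc_box_join_vec trunc_box_nonneg) (simp add: trunc_box_def)
    qed
    then have [measurable]: "?B \<in> sets borel"
      using measurable_sets[OF borel_measurable_lower_vec S] by auto
    have ind: "indicator ?B (join_vec x y) = (indicator {0..} x * indicator S y :: ennreal)" for x y
      by (auto simp: indicator_def)
    have "emeasure N (X -` ?B \<inter> space N) = (\<integral>\<^sup>+x. ?f x * indicator ?B x \<partial>lborel)"
      by (rule distributed_emeasure[OF dX]) simp
    also have "\<dots> = (\<integral>\<^sup>+y. (\<integral>\<^sup>+x. ?f (join_vec x y) * indicator {0..} x \<partial>lborel) * indicator S y \<partial>lborel)"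
      by (subst nn_integral_lborel_join_vec)
        (auto intro!: nn_integral_cong simp: ind simp flip: nn_integral_multc mult.assoc)
    \<comment> \<open>The factor D undoes the denominator of the SUT density.\<close>
    also have "\<dots> = (\<integral>\<^sup>+y. ennreal (A * D) * (ennreal (?g y) * indicator S y) \<partial>lborel)"
      using A D
      by (intro nn_integral_cong) (simp add: orthant sut_density_def flip: D_def ennreal_mult' mult.assoc)
    also have "\<dots> = ennreal (A * D) * emeasure M (Y -` S \<inter> space M)"
      using distributed_emeasure[OF dY, of S] by (simp add: nn_integral_cmult)
    finally show "emeasure N (X -` ?B \<inter> space N) = ennreal (A * D) * emeasure M (Y -` S \<inter> space M)" .
  qed
qed

text \<open>The existence equivalence gives the equation its content, since the integral of a
  non-integrable function is 0 by convention. Both claims follow from one equality of conditional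
  laws, for Y and X on possibly different probability spaces.\<close>

theorem corollary2:
  fixes \<mu> :: "real ^ 'p" and \<Sigma> R :: "real ^ 'p ^ 'p" and \<Lambda> :: "real ^ 'q ^ 'p"
    and \<tau> :: "real ^ 'q" and \<Psi> :: "real ^ 'q ^ 'q" and \<nu> :: real
    and M :: "'m measure" and Y :: "'m \<Rightarrow> real ^ 'p"
    and N :: "'n measure" and X :: "'n \<Rightarrow> real ^ ('q + 'p)"
    and a b :: "ereal ^ 'p" and k :: "nat ^ 'p"
  defines "\<xi> \<equiv> join_vec \<tau> \<mu>"
    and "\<Omega> \<equiv> block_mat (\<Psi> + transpose \<Lambda> ** \<Lambda>) (transpose (R ** \<Lambda>)) (R ** \<Lambda>) \<Sigma>"
    and "\<kappa> \<equiv> join_vec 0 k"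
    and "\<alpha> \<equiv> join_vec 0 a"
    and "\<beta> \<equiv> join_vec (\<chi> i. \<infinity>) b"
  assumes "\<nu> > 0"
    and "pos_def_mat \<Sigma>"
    and "symmetric_sqrt_mat \<Sigma> R"
    and "correlation_mat \<Psi>"
    and "prob_space M" and "sut_distributed M Y \<mu> \<Sigma> R \<Lambda> \<tau> \<nu> \<Psi>"
    and "prob_space N" and "t_distributed N X \<xi> \<Omega> \<nu>"
    and "measure M (trunc_event M Y a b) > 0"
  shows "(trunc_moment_exists M Y a b k \<longleftrightarrow> trunc_moment_exists N X \<alpha> \<beta> \<kappa>) \<and>
    trunc_moment M Y a b k = trunc_moment N X \<alpha> \<beta> \<kappa>"
proof -
  interpret M: prob_space M by fact
  interpret N: prob_space N by fact
  have [measurable]: "Y \<in> borel_measurable M" "X \<in> borel_measurable N"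
    using assms by (auto simp: sut_distributed_def t_distributed_def distributed_def)
  have "pos_def_mat \<Psi>"
    using assms by (simp add: correlation_mat_def)
  from sut_law_proportional[OF \<open>\<nu> > 0\<close> \<open>pos_def_mat \<Sigma>\<close> \<open>symmetric_sqrt_mat \<Sigma> R\<close> this
      \<open>prob_space M\<close> \<open>sut_distributed M Y \<mu> \<Sigma> R \<Lambda> \<tau> \<nu> \<Psi>\<close> \<open>prob_space N\<close>
      \<open>t_distributed N X \<xi> \<Omega> \<nu>\<close>[unfolded \<xi>_def \<Omega>_def]]
  obtain c where c: "0 < c" and law: "\<And>S. S \<in> sets borel \<Longrightarrow>
      emeasure N (X -` {join_vec x y | x y. 0 \<le> x \<and> y \<in> S} \<inter> space N) =
      ennreal c * emeasure M (Y -` S \<inter> space M)"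
    by blast
  define E F where "E = trunc_event M Y a b" and "F = trunc_event N X \<alpha> \<beta>"
  have sets [measurable]: "E \<in> sets M" "F \<in> sets N"
    by (auto simp: E_def F_def trunc_event_def)
  \<comment> \<open>\<open>F\<close> with X_2 in S means X_1 \<ge> 0 and X_2 in the box intersected
    with S, a set to which \<open>law\<close> applies.\<close>
  have prob: "N.prob (F \<inter> (\<lambda>\<omega>. lower_vec (X \<omega>)) -` S) = c * M.prob (E \<inter> Y -` S)"
    if [measurable]: "S \<in> sets borel" for S
  proof -
    have "F \<inter> (\<lambda>\<omega>. lower_vec (X \<omega>)) -` S =
        X -` {join_vec x y | x y. 0 \<le> x \<and> y \<in> trunc_box a b \<inter> S} \<inter> space N"
    proof (rule set_eqI)
      fix \<omega>
      obtain x y where "X \<omega> = join_vec x y"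
        by (rule join_vec_cases)
      then show "\<omega> \<in> F \<inter> (\<lambda>\<omega>. lower_vec (X \<omega>)) -` S \<longleftrightarrow>
          \<omega> \<in> X -` {join_vec x y | x y. 0 \<le> x \<and> y \<in> trunc_box a b \<inter> S} \<inter> space N"
        by (auto simp: F_def trunc_event_def \<alpha>_def \<beta>_def trunc_box_join_vec trunc_box_nonneg)
    qed
    moreover have "E \<inter> Y -` S = Y -` (trunc_box a b \<inter> S) \<inter> space M"
      by (auto simp: E_def trunc_event_def)
    ultimately show ?thesis
      using law[of "trunc_box a b \<inter> S"] c by (simp add: measure_def enn2real_mult)
  qed
  have E_pos: "0 < M.prob E"
    using assms by (simp add: E_def)
  \<comment> \<open>Hence the conditioning event of X has positive probability too.\<close>
  have F_eq: "N.prob F = c * M.prob E"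
    using prob[of UNIV] by simp
  let ?M = "uniform_measure M E" and ?N = "uniform_measure N F" and ?X = "\<lambda>\<omega>. lower_vec (X \<omega>)"
  \<comment> \<open>The constant \<open>c\<close> occurs in numerator and denominator and
    cancels.\<close>
  have distr_eq: "distr ?M borel Y = distr ?N borel ?X"
  proof (rule measure_eqI)
    fix S :: "(real ^ 'p) set"
    assume "S \<in> sets (distr ?M borel Y)"
    then have [measurable]: "S \<in> sets borel"
      by simp
    have "E \<inter> (Y -` S \<inter> space M) = E \<inter> Y -` S" "F \<inter> (?X -` S \<inter> space N) = F \<inter> ?X -` S"
      using sets sets.sets_into_space by blast+
    then have "emeasure (distr ?M borel Y) S = emeasure M (E \<inter> Y -` S) / emeasure M E"
      and "emeasure (distr ?N borel ?X) S = emeasure N (F \<inter> ?X -` S) / emeasure N F"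
      by (simp_all add: emeasure_distr)
    then show "emeasure (distr ?M borel Y) S = emeasure (distr ?N borel ?X) S"
      using c E_pos by (simp add: M.emeasure_eq_measure N.emeasure_eq_measure prob F_eq divide_ennreal)
  qed simp
  \<comment> \<open>The zero exponents on X_1 contribute the factor 1.\<close>
  have power: "vec_power (X \<omega>) \<kappa> = vec_power (?X \<omega>) k" for \<omega>
    by (rule join_vec_cases[of "X \<omega>"]) (simp add: \<kappa>_def vec_power_join_vec, simp add: vec_power_def)
  have "trunc_moment_exists M Y a b k \<longleftrightarrow> integrable (distr ?M borel Y) (\<lambda>y. vec_power y k)"
    by (simp add: trunc_moment_exists_def integrable_distr_eq flip: E_def)
  moreover have "trunc_moment_exists N X \<alpha> \<beta> \<kappa> \<longleftrightarrow> integrable (distr ?N borel ?X) (\<lambda>y. vec_power y k)"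
    by (simp add: trunc_moment_exists_def integrable_distr_eq power flip: F_def)
  moreover have "trunc_moment M Y a b k = (LINT y|distr ?M borel Y. vec_power y k)"
    by (simp add: trunc_moment_def integral_distr flip: E_def)
  moreover have "trunc_moment N X \<alpha> \<beta> \<kappa> = (LINT y|distr ?N borel ?X. vec_power y k)"
    by (simp add: trunc_moment_def integral_distr power flip: F_def)
  ultimately show ?thesis
    by (simp add: distr_eq)
qed

end
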